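(* Let $\mathcal{H}$ be a real Hilbert space, let $\alpha\in(0,1)$, and let $T:\mathcal{H}\to\mathcal{H}$ be an $\alpha$-averaged nonexpansive operator with $\mathrm{Fix}(T)\neq\varnothing$. Let $\{x^k\}_{k\in\mathbb{N}}$ be a sequence generated by the TKMA iteration with operator $T$, parameter $t$ and starting point $x^0\in\mathcal{H}$, and assume $Tx^k\neq x^k$ for all $k\in\mathbb{N}$. Suppose that either (a) $\alpha\in(0,1/2]$ and $t\in(0,1)$, or (b) $\alpha\in(1/2,1)$ and $t\in\left(0,\frac{(1-\alpha)^2+(1-\alpha)\sqrt{(1-\alpha)^2+8\alpha^2}}{4\alpha^2}\right)$. Then $\{x^k\}$ converges weakly to a fixed point of $T$.
   Context: $\mathcal{I}$ denotes the identity operator on $\mathcal{H}$, and $\mathrm{Fix}(T)=\{x\in\mathcal{H}: Tx=x\}$. An operator $\mathcal{N}:\mathcal{H}\to\mathcal{H}$ is nonexpansive if $\|\mathcal{N}x-\mathcal{N}y\|\le\|x-y\|$ for all $x,y\in\mathcal{H}$. For $\alpha\in(0,1)$, $T$ is $\alpha$-averaged nonexpansive if there is a nonexpansive $\mathcal{N}:\mathcal{H}\to\mathcal{H}$ with $T=(1-\alpha)\mathcal{I}+\alpha\mathcal{N}$. For $\theta\in\mathbb{R}$, $T^{\theta}:=T+\theta(T-\mathcal{I})$; $T^2:=T\circ T$. TKMA iteration: given $t\in(0,1)$ and $x^0\in\mathcal{H}$, $$x^{k+1}=(1-t)T^2x^k+tT^{\theta_k}x^k,\qquad \theta_k:=\frac{-\langle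 Tx^k-x^k,\,Tx^k-T^2x^k\rangle}{\|Tx^k-x^k\|^2},\qquad k\in\mathbb{N}=\{0,1,2,\dots\}.$$ *)

theory Defs
  imports "HOL-Analysis.Analysis"
begin

text \<open>A real Hilbert space is a type of class \<open>real_inner\<close> and \<open>complete_space\<close>.\<close>

definition Fix :: "('a \<Rightarrow> 'a) \<Rightarrow> 'a set" where
  "Fix T = {x. T x = x}"

definition nonexpansive :: "('a::real_normed_vector \<Rightarrow> 'a) \<Rightarrow> bool" where
  "nonexpansive N \<longleftrightarrow> (\<forall>x y. norm (N x - N y) \<le> norm (x - y))"

definition averaged_nonexpansive :: "real \<Rightarrow> ('a::real_normed_vector \<Rightarrow> 'a) \<Rightarrow> bool" where
  "averaged_nonexpansive \<alpha> T \<longleftrightarrow>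
     (\<exists>N. nonexpansive N \<and> T = (\<lambda>x. (1 - \<alpha>) *\<^sub>R x + \<alpha> *\<^sub>R N x))"

definition relax :: "('a::real_vector \<Rightarrow> 'a) \<Rightarrow> real \<Rightarrow> 'a \<Rightarrow> 'a" where
  "relax T \<theta> = (\<lambda>x. T x + \<theta> *\<^sub>R (T x - x))"

text \<open>At a fixed point of \<open>T\<close> the denominator vanishes and the quotient is \<open>0\<close> by convention.\<close>

definition tkma_theta :: "('a::real_inner \<Rightarrow> 'a) \<Rightarrow> 'a \<Rightarrow> real" where
  "tkma_theta T x = - inner (T x - x) (T x - (T \<circ> T) x) / (norm (T x - x))\<^sup>2"

definition tkma_sequence ::
    "('a::real_inner \<Rightarrow> 'a) \<Rightarrow> real \<Rightarrow> 'a \<Rightarrow> (nat \<Rightarrow> 'a) \<Rightarrow> bool" where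
  "tkma_sequence T t x0 x \<longleftrightarrow>
     x 0 = x0 \<and>
     (\<forall>k. x (Suc k) = (1 - t) *\<^sub>R (T \<circ> T) (x k) + t *\<^sub>R relax T (tkma_theta T (x k)) (x k))"

text \<open>Sequential convergence in the weak topology, i.e. the topology induced by all continuous
  linear functionals.\<close>

definition weakly_converges :: "(nat \<Rightarrow> 'a::real_normed_vector) \<Rightarrow> 'a \<Rightarrow> bool" where
  "weakly_converges x p \<longleftrightarrow>
     (\<forall>f :: 'a \<Rightarrow> real. bounded_linear f \<longrightarrow> (\<lambda>k. f (x k)) \<longlonglongrightarrow> f p)"

end

theory Submission
  imports Defs
begin

text \<open>
  Write \<open>\<kappa> = (1 - \<alpha>) / \<alpha>\<close>, \<open>a = T x - x\<close> and \<open>b = T (T x) - T x\<close>. The number \<open>\<theta>\<close> is chosen so that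
  \<open>\<theta> a\<close> is the orthogonal projection of \<open>b\<close> onto the line spanned by \<open>a\<close>; hence the step leads from
  \<open>x\<close> to \<open>T x + (1 - t) b + t \<theta> a\<close>, which keeps the component of \<open>b\<close> along \<open>a\<close> and damps the orthogonal
  one. Averagedness says that an application of \<open>T\<close> shrinks squared distances by \<open>\<kappa>\<close> times the squared
  change of the displacement. Used between \<open>x\<close>, \<open>T x\<close> and a fixed point \<open>z\<close>, it gives
  \<open>\<parallel>x\<^sup>+ - z\<parallel>\<^sup>2 \<le> \<parallel>x - z\<parallel>\<^sup>2 - q(\<theta>) \<parallel>a\<parallel>\<^sup>2\<close> with a quadratic polynomial \<open>q\<close>. Both
  parameter ranges lie inside \<open>t < min 1 \<kappa>\<close>, and there \<open>\<bar>\<theta>\<bar> \<le> 1\<close> implies that \<open>q(\<theta>)\<close> is at least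
  \<open>min 1 \<kappa> - t > 0\<close> (\<open>descent_coefficient\<close>). So the distances to all fixed points decrease (\<open>tkma_step_descent\<close>) and \<open>T x\<^sub>k - x\<^sub>k\<close> tends to \<open>0\<close>.

  Weak convergence then follows by means of asymptotic centres, the minimisers of
  \<open>limsup \<parallel>x\<^sub>k - y\<parallel>\<^sup>2\<close> over \<open>y\<close>. The limsup is taken along an arbitrary filter, so that subsequences are
  covered by passing to finer filters. In a Hilbert space the centre exists and is unique because
  the limsup inherits the parallelogram law as an inequality. A nonexpansive map with vanishing
  displacements sends the centre to another minimiser, so the centre is a fixed point. At fixed
  points the distances converge, hence the limsup does not change under refinement of the filter
  and every refinement has the same centre \<open>c\<close>. If some \<open>\<langle>v, x\<^sub>k - c\<rangle>\<close> stayed above a positive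
  constant along a refinement, moving \<open>c\<close> slightly towards \<open>v\<close> would decrease the limsup there, a
  contradiction. The Riesz representation theorem transfers this from inner products to all
  bounded functionals; like the existence of centres, it is an instance of the same minimisation
  principle (\<open>uniformly_convex_minimiser\<close>).
\<close>

section \<open>Minimisation of uniformly convex functions\<close>

lemma norm_midpoint_sq:
  fixes x y z :: "'a::real_inner"
  shows "(norm (z - midpoint x y))\<^sup>2
    = ((norm (z - x))\<^sup>2 + (norm (z - y))\<^sup>2) / 2 - (norm (x - y))\<^sup>2 / 4"
  unfolding midpoint_def power2_norm_eq_inner
  by (simp add: inner_diff inner_add inner_commute field_simps)

text \<open>By the midpoint inequality two points whose values are close to the infimum are close to each
  other, so every minimising sequence is Cauchy. The same inequality, applied to the minimiser
  and another point, bounds the value there from below by a quadratic; uniqueness is the case of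
  equal values.\<close>

lemma uniformly_convex_minimiser:
  fixes g :: "'a::{real_inner, complete_space} \<Rightarrow> real"
  assumes S: "closed S" "S \<noteq> {}"
    and mid: "\<And>y z. y \<in> S \<Longrightarrow> z \<in> S \<Longrightarrow> midpoint y z \<in> S"
    and cont: "continuous_on S g"
    and nonneg: "\<And>y. y \<in> S \<Longrightarrow> 0 \<le> g y"
    and conv: "\<And>y z. y \<in> S \<Longrightarrow> z \<in> S \<Longrightarrow>
      g (midpoint y z) \<le> (g y + g z) / 2 - (norm (y - z))\<^sup>2 / 4"
  obtains c where "c \<in> S" "\<And>y. y \<in> S \<Longrightarrow> g c + (norm (c - y))\<^sup>2 / 2 \<le> g y"
proof -
  define m where "m = Inf (g ` S)"
  have bdd: "bdd_below (g ` S)"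
    using nonneg by (intro bdd_belowI[of _ 0]) auto
  have lower: "m \<le> g y" if "y \<in> S" for y
    unfolding m_def using bdd that by (simp add: cInf_lower)
  have "\<exists>y\<in>S. g y < m + inverse (real (Suc n))" for n
    using cInf_lessD[of "g ` S" "m + inverse (real (Suc n))"] S(2) unfolding m_def by auto
  then obtain u where uS: "\<And>n. u n \<in> S" and um: "\<And>n. g (u n) < m + inverse (real (Suc n))"
    by metis
  have dist: "(norm (u i - u j))\<^sup>2 \<le> 4 * inverse (real (Suc M))" if "M \<le> i" "M \<le> j" for i j M
  proof -
    have "inverse (real (Suc i)) \<le> inverse (real (Suc M))"
      "inverse (real (Suc j)) \<le> inverse (real (Suc M))"
      using that by (auto intro!: le_imp_inverse_le)
    moreover have "m \<le> (g (u i) + g (u j)) / 2 - (norm (u i - u j))\<^sup>2 / 4"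
      using conv[OF uS uS, of i j] lower[OF mid[OF uS uS], of i j] by linarith
    ultimately show ?thesis
      using um[of i] um[of j] by argo
  qed
  have "Cauchy u"
  proof (rule CauchyI)
    fix e :: real assume "0 < e"
    then obtain M where M: "inverse (real (Suc M)) < e\<^sup>2 / 4"
      using reals_Archimedean[of "e\<^sup>2 / 4"] by auto
    have "norm (u i - u j) < e" if "M \<le> i" "M \<le> j" for i j
    proof (rule power2_less_imp_less)
      show "(norm (u i - u j))\<^sup>2 < e\<^sup>2"
        using dist[OF that] M by argo
    qed (use \<open>0 < e\<close> in simp)
    then show "\<exists>M. \<forall>i\<ge>M. \<forall>j\<ge>M. norm (u i - u j) < e"
      by blast
  qed
  then obtain c where uc: "u \<longlonglongrightarrow> c"
    using Cauchy_convergent convergent_def by blast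
  have cS: "c \<in> S"
    using closed_sequentially[OF S(1) _ uc] uS by blast
  have "(\<lambda>n. g (u n)) \<longlonglongrightarrow> g c"
    using continuous_on_tendsto_compose[OF cont uc cS] uS by simp
  moreover have "(\<lambda>n. m + inverse (real (Suc n))) \<longlonglongrightarrow> m + 0"
    by (intro tendsto_intros LIMSEQ_inverse_real_of_nat)
  ultimately have "g c \<le> m + 0"
    by (rule LIMSEQ_le) (use um in \<open>auto intro: less_imp_le\<close>)
  then have gc: "g c \<le> m" by simp
  have "g c + (norm (c - y))\<^sup>2 / 2 \<le> g y" if "y \<in> S" for y
    using conv[OF cS that] lower[OF mid[OF cS that]] gc by argo
  with cS show thesis
    by (rule that)
qed

text \<open>The representing vector is a multiple of the point of least norm in the hyperplane \<open>f = 1\<close>, which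
  is orthogonal to the kernel of \<open>f\<close>.\<close>

lemma riesz_representation:
  fixes f :: "'a::{real_inner, complete_space} \<Rightarrow> real"
  assumes "bounded_linear f"
  obtains v where "\<And>y. f y = inner v y"
proof (cases "\<exists>y. f y \<noteq> 0")
  case False
  then show thesis
    using that[of 0] by simp
next
  case True
  interpret f: bounded_linear f by fact
  from True obtain y0 where y0: "f y0 \<noteq> 0" by blast
  let ?S = "{y. f y = 1}"
  have "inverse (f y0) *\<^sub>R y0 \<in> ?S"
    using y0 by (simp add: f.scaleR)
  then have nonempty: "?S \<noteq> {}" by blast
  obtain c where cS: "c \<in> ?S"
    and minS: "\<And>y. y \<in> ?S \<Longrightarrow> (norm c)\<^sup>2 + (norm (c - y))\<^sup>2 / 2 \<le> (norm y)\<^sup>2"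
  proof (rule uniformly_convex_minimiser[of ?S "\<lambda>y. (norm y)\<^sup>2", OF _ nonempty])
    show "closed ?S"
      by (intro closed_Collect_eq continuous_intros f.continuous_on)
    show "continuous_on ?S (\<lambda>y. (norm y)\<^sup>2)"
      by (intro continuous_intros)
    show "midpoint y z \<in> ?S" if "y \<in> ?S" "z \<in> ?S" for y z
      using that by (simp add: midpoint_def f.scaleR f.add)
    show "(norm (midpoint y z))\<^sup>2 \<le> ((norm y)\<^sup>2 + (norm z)\<^sup>2) / 2 - (norm (y - z))\<^sup>2 / 4"
      for y z :: 'a
      using norm_midpoint_sq[of 0 y z] by simp
  qed simp_all
  have c: "f c = 1" and min: "\<And>y. f y = 1 \<Longrightarrow> (norm c)\<^sup>2 + (norm (c - y))\<^sup>2 / 2 \<le> (norm y)\<^sup>2"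
    using cS minS by auto
  have orth: "inner c w = 0" if "f w = 0" for w
  proof (cases "w = 0")
    case False
    \<comment> \<open>the parameter minimises \<open>\<parallel>c + s w\<parallel>\<close> over \<open>s\<close>\<close>
    define s where "s = - inner c w / (norm w)\<^sup>2"
    have "f (c + s *\<^sub>R w) = 1"
      using that c by (simp add: f.add f.scaleR)
    from min[OF this] have "(norm c)\<^sup>2 \<le> (norm (c + s *\<^sub>R w))\<^sup>2"
      using zero_le_power2[of "norm (c - (c + s *\<^sub>R w))"] by linarith
    also have "\<dots> = (norm c)\<^sup>2 + 2 * s * inner c w + s * (s * (norm w)\<^sup>2)"
      by (simp add: power2_norm_eq_inner inner_add inner_commute algebra_simps)
    also have "s * (norm w)\<^sup>2 = - inner c w"
      using False by (simp add: s_def)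
    finally have "0 \<le> s * inner c w" by simp
    then have "(inner c w)\<^sup>2 / (norm w)\<^sup>2 \<le> 0"
      by (simp add: s_def power2_eq_square)
    with False show ?thesis
      by (simp add: divide_le_0_iff)
  qed simp
  have "c \<noteq> 0"
    using c f.zero by auto
  have "f y = inner (inverse ((norm c)\<^sup>2) *\<^sub>R c) y" for y
  proof -
    have "f (y - f y *\<^sub>R c) = 0"
      by (simp add: f.diff f.scaleR c)
    from orth[OF this] have "inner c y = f y * (norm c)\<^sup>2"
      by (simp add: inner_diff power2_norm_eq_inner)
    then show ?thesis
      using \<open>c \<noteq> 0\<close> by simp
  qed
  then show thesis
    by (rule that)
qed

section \<open>Asymptotic centres\<close>

text \<open>This is the upper limit of the squared distances, with values in the reals; it is
  meaningful when the sequence is bounded along a proper filter. Squares are used because they turn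
  the parallelogram law into the uniform convexity that the minimisation needs.\<close>

definition asymp_radius_sq :: "'b filter \<Rightarrow> ('b \<Rightarrow> 'a::real_inner) \<Rightarrow> 'a \<Rightarrow> real" where
  "asymp_radius_sq F x y = Inf {r. \<forall>\<^sub>F k in F. (norm (x k - y))\<^sup>2 \<le> r}"

context
  fixes F :: "'b filter" and x :: "'b \<Rightarrow> 'a::real_inner" and R :: real
  assumes F: "F \<noteq> bot" and R: "\<And>k. norm (x k) \<le> R"
begin

lemma asymp_radius_sq_bdd:
  "bdd_below {r. \<forall>\<^sub>F k in F. (norm (x k - y))\<^sup>2 \<le> r}"
proof (rule bdd_belowI[of _ 0], clarify)
  fix r assume "\<forall>\<^sub>F k in F. (norm (x k - y))\<^sup>2 \<le> r"
  then obtain k where "(norm (x k - y))\<^sup>2 \<le> r"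
    using eventually_happens'[OF F] by blast
  then show "0 \<le> r"
    using zero_le_power2[of "norm (x k - y)"] by linarith
qed

lemma asymp_radius_sq_le:
  assumes "\<forall>\<^sub>F k in F. (norm (x k - y))\<^sup>2 \<le> r"
  shows "asymp_radius_sq F x y \<le> r"
  unfolding asymp_radius_sq_def using assms by (intro cInf_lower asymp_radius_sq_bdd) simp

lemma asymp_radius_sq_nonempty: "{r. \<forall>\<^sub>F k in F. (norm (x k - y))\<^sup>2 \<le> r} \<noteq> {}"
proof -
  have "(norm (x k - y))\<^sup>2 \<le> (R + norm y)\<^sup>2" for k
    using norm_triangle_ineq4[of "x k" y] R[of k] by (intro power_mono) auto
  then have "(R + norm y)\<^sup>2 \<in> {r. \<forall>\<^sub>F k in F. (norm (x k - y))\<^sup>2 \<le> r}"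
    by simp
  then show ?thesis by blast
qed

lemma asymp_radius_sq_eventually:
  assumes "asymp_radius_sq F x y < r"
  shows "\<forall>\<^sub>F k in F. (norm (x k - y))\<^sup>2 \<le> r"
proof -
  obtain s where "\<forall>\<^sub>F k in F. (norm (x k - y))\<^sup>2 \<le> s" "s < r"
    using cInf_lessD[OF asymp_radius_sq_nonempty] assms unfolding asymp_radius_sq_def by blast
  then show ?thesis
    by (auto elim!: eventually_mono)
qed

lemma asymp_radius_sq_nonneg: "0 \<le> asymp_radius_sq F x y"
proof (rule field_le_epsilon)
  fix e :: real assume "0 < e"
  then have "\<forall>\<^sub>F k in F. (norm (x k - y))\<^sup>2 \<le> asymp_radius_sq F x y + e"
    by (intro asymp_radius_sq_eventually) simp
  then obtain k where "(norm (x k - y))\<^sup>2 \<le> asymp_radius_sq F x y + e"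
    using eventually_happens'[OF F] by blast
  then show "0 \<le> asymp_radius_sq F x y + e"
    using zero_le_power2[of "norm (x k - y)"] by linarith
qed

lemma asymp_radius_sq_mono:
  assumes "\<And>e. 0 < e \<Longrightarrow> \<forall>\<^sub>F k in F. (norm (x k - y))\<^sup>2 \<le> (norm (x k - z))\<^sup>2 + d + e"
  shows "asymp_radius_sq F x y \<le> asymp_radius_sq F x z + d"
proof (rule field_le_epsilon)
  fix e :: real assume "0 < e"
  then have "\<forall>\<^sub>F k in F. (norm (x k - z))\<^sup>2 \<le> asymp_radius_sq F x z + e / 2"
    by (intro asymp_radius_sq_eventually) simp
  moreover have "\<forall>\<^sub>F k in F. (norm (x k - y))\<^sup>2 \<le> (norm (x k - z))\<^sup>2 + d + e / 2"
    using assms \<open>0 < e\<close> by simp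
  ultimately have "\<forall>\<^sub>F k in F. (norm (x k - y))\<^sup>2 \<le> asymp_radius_sq F x z + d + e"
    by eventually_elim argo
  then show "asymp_radius_sq F x y \<le> asymp_radius_sq F x z + d + e"
    by (rule asymp_radius_sq_le)
qed

lemma asymp_radius_sq_midpoint:
  "asymp_radius_sq F x (midpoint y z)
    \<le> (asymp_radius_sq F x y + asymp_radius_sq F x z) / 2 - (norm (y - z))\<^sup>2 / 4"
proof (rule field_le_epsilon)
  fix e :: real assume "0 < e"
  then have "\<forall>\<^sub>F k in F. (norm (x k - y))\<^sup>2 \<le> asymp_radius_sq F x y + e"
    "\<forall>\<^sub>F k in F. (norm (x k - z))\<^sup>2 \<le> asymp_radius_sq F x z + e"
    by (simp_all add: asymp_radius_sq_eventually)
  then have "\<forall>\<^sub>F k in F. (norm (x k - midpoint y z))\<^sup>2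
    \<le> (asymp_radius_sq F x y + asymp_radius_sq F x z) / 2 - (norm (y - z))\<^sup>2 / 4 + e"
    by eventually_elim (unfold norm_midpoint_sq, argo)
  then show "asymp_radius_sq F x (midpoint y z)
    \<le> (asymp_radius_sq F x y + asymp_radius_sq F x z) / 2 - (norm (y - z))\<^sup>2 / 4 + e"
    by (rule asymp_radius_sq_le)
qed

lemma asymp_radius_sq_diff_le:
  "asymp_radius_sq F x y \<le> asymp_radius_sq F x z + norm (y - z) * (2 * R + norm y + norm z)"
proof (rule asymp_radius_sq_mono, rule always_eventually, rule allI)
  fix e :: real and k assume "0 < e"
  have "(norm (x k - y))\<^sup>2 - (norm (x k - z))\<^sup>2 = inner (y - z) (y + z - 2 *\<^sub>R x k)"
    unfolding power2_norm_eq_inner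
    by (simp add: inner_diff inner_add inner_commute algebra_simps)
  also have "\<dots> \<le> norm (y - z) * norm (y + z - 2 *\<^sub>R x k)"
    by (rule norm_cauchy_schwarz)
  also have "\<dots> \<le> norm (y - z) * (2 * R + norm y + norm z)"
  proof (rule mult_left_mono)
    show "norm (y + z - 2 *\<^sub>R x k) \<le> 2 * R + norm y + norm z"
      using norm_triangle_ineq4[of "y + z" "2 *\<^sub>R x k"] norm_triangle_ineq[of y z] R[of k] by simp
  qed simp
  finally show "(norm (x k - y))\<^sup>2
      \<le> (norm (x k - z))\<^sup>2 + norm (y - z) * (2 * R + norm y + norm z) + e"
    using \<open>0 < e\<close> by simp
qed

lemma asymp_radius_sq_continuous: "continuous_on UNIV (asymp_radius_sq F x)"
proof -
  have "(asymp_radius_sq F x \<longlongrightarrow> asymp_radius_sq F x z) (at z)" for z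
  proof -
    have "((\<lambda>y. norm (y - z) * (2 * R + norm y + norm z))
        \<longlongrightarrow> norm (z - z) * (2 * R + norm z + norm z)) (at z)"
      by (intro tendsto_intros)
    then have "((\<lambda>y. norm (y - z) * (2 * R + norm y + norm z)) \<longlongrightarrow> 0) (at z)"
      by simp
    moreover have "norm (asymp_radius_sq F x y - asymp_radius_sq F x z)
        \<le> norm (y - z) * (2 * R + norm y + norm z)" for y
      using asymp_radius_sq_diff_le[of y z] asymp_radius_sq_diff_le[of z y]
      by (simp add: norm_minus_commute[of z y] algebra_simps)
    ultimately have "((\<lambda>y. asymp_radius_sq F x y - asymp_radius_sq F x z) \<longlongrightarrow> 0) (at z)"
      by (metis (no_types, lifting) Lim_null_comparison always_eventually)
    then show ?thesis
      by (simp add: LIM_zero_iff)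
  qed
  then show ?thesis
    by (simp add: continuous_on_def)
qed

lemma asymp_radius_sq_eq_lim:
  assumes "((\<lambda>k. (norm (x k - y))\<^sup>2) \<longlongrightarrow> l) F"
  shows "asymp_radius_sq F x y = l"
proof (rule antisym)
  show "asymp_radius_sq F x y \<le> l"
  proof (rule field_le_epsilon)
    fix e :: real assume "0 < e"
    then have "\<forall>\<^sub>F k in F. (norm (x k - y))\<^sup>2 < l + e"
      by (intro order_tendstoD(2)[OF assms]) simp
    then show "asymp_radius_sq F x y \<le> l + e"
      by (intro asymp_radius_sq_le) (auto elim: eventually_mono)
  qed
  show "l \<le> asymp_radius_sq F x y"
  proof (rule field_le_epsilon)
    fix e :: real assume "0 < e"
    then have "\<forall>\<^sub>F k in F. (norm (x k - y))\<^sup>2 \<le> asymp_radius_sq F x y + e"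
      by (intro asymp_radius_sq_eventually) simp
    then show "l \<le> asymp_radius_sq F x y + e"
      by (rule tendsto_upperbound[OF assms _ F])
  qed
qed

end

text \<open>The minimiser condition is stated in the quantitative form that the midpoint inequality gives,
  so that it contains the uniqueness of the centre.\<close>

definition is_asymp_centre :: "'b filter \<Rightarrow> ('b \<Rightarrow> 'a::real_inner) \<Rightarrow> 'a \<Rightarrow> bool" where
  "is_asymp_centre F x c \<longleftrightarrow>
     (\<forall>y. asymp_radius_sq F x c + (norm (c - y))\<^sup>2 / 2 \<le> asymp_radius_sq F x y)"

lemma asymp_centre_exists:
  fixes x :: "'b \<Rightarrow> 'a::{real_inner, complete_space}"
  assumes "F \<noteq> bot" "\<And>k. norm (x k) \<le> R"
  obtains c where "is_asymp_centre F x c"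
proof (rule uniformly_convex_minimiser[of UNIV "asymp_radius_sq F x"])
  show "continuous_on UNIV (asymp_radius_sq F x)"
    by (rule asymp_radius_sq_continuous[OF assms])
  fix c assume "\<And>y. y \<in> UNIV \<Longrightarrow>
    asymp_radius_sq F x c + (norm (c - y))\<^sup>2 / 2 \<le> asymp_radius_sq F x y"
  then show thesis
    by (intro that[of c]) (simp add: is_asymp_centre_def)
qed (simp_all add: asymp_radius_sq_nonneg[OF assms] asymp_radius_sq_midpoint[OF assms])

lemma norm_sq_le_if_norm_le_add:
  fixes p q :: "'a::real_inner" and e M :: real
  assumes "norm p \<le> norm q + d" "norm q \<le> M" "0 \<le> d" "d \<le> 1" "d * (2 * M + 1) \<le> e"
  shows "(norm p)\<^sup>2 \<le> (norm q)\<^sup>2 + e"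
proof -
  have "(norm p)\<^sup>2 \<le> (norm q + d)\<^sup>2"
    using assms by (intro power_mono) auto
  also have "\<dots> = (norm q)\<^sup>2 + d * (2 * norm q + d)"
    by (simp add: power2_eq_square algebra_simps)
  also have "d * (2 * norm q + d) \<le> d * (2 * M + 1)"
    using assms by (intro mult_left_mono) auto
  finally show ?thesis
    using assms(5) by simp
qed

text \<open>This replaces the demiclosedness principle: \<open>T\<close> does not increase the distances to the sequence
  in the limit, so \<open>T c\<close> is a minimiser along with \<open>c\<close> and agrees with it by uniqueness.\<close>

lemma asymp_centre_fixed:
  fixes x :: "'b \<Rightarrow> 'a::real_inner"
  assumes F: "F \<noteq> bot" and R: "\<And>k. norm (x k) \<le> R"
    and c: "is_asymp_centre F x c"
    and T: "nonexpansive T"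
    and reg: "((\<lambda>k. norm (T (x k) - x k)) \<longlongrightarrow> 0) F"
  shows "c \<in> Fix T"
proof -
  define M where "M = R + norm c"
  have M: "norm (x k - c) \<le> M" for k
    unfolding M_def using norm_triangle_ineq4[of "x k" c] R[of k] by linarith
  have "asymp_radius_sq F x (T c) \<le> asymp_radius_sq F x c + 0"
  proof (rule asymp_radius_sq_mono[OF F R])
    fix e :: real assume "0 < e"
    have "((\<lambda>k. norm (T (x k) - x k) * (2 * M + 1)) \<longlongrightarrow> 0 * (2 * M + 1)) F"
      by (intro tendsto_intros reg)
    then have "\<forall>\<^sub>F k in F. norm (T (x k) - x k) * (2 * M + 1) < e"
      using \<open>0 < e\<close> by (intro order_tendstoD(2)) auto
    moreover have "\<forall>\<^sub>F k in F. norm (T (x k) - x k) < 1"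
      using reg by (intro order_tendstoD(2)) auto
    ultimately show "\<forall>\<^sub>F k in F. (norm (x k - T c))\<^sup>2 \<le> (norm (x k - c))\<^sup>2 + 0 + e"
    proof eventually_elim
      case (elim k)
      have "norm (x k - T c) \<le> norm (x k - T (x k)) + norm (T (x k) - T c)"
        using norm_triangle_ineq[of "x k - T (x k)" "T (x k) - T c"] by simp
      also have "norm (T (x k) - T c) \<le> norm (x k - c)"
        using T by (simp add: nonexpansive_def)
      finally have "norm (x k - T c) \<le> norm (x k - c) + norm (T (x k) - x k)"
        by (simp add: norm_minus_commute)
      then show ?case
        using norm_sq_le_if_norm_le_add[OF _ M, of "x k - T c" k] elim by simp
    qed
  qed
  moreover have "asymp_radius_sq F x c + (norm (c - T c))\<^sup>2 / 2 \<le> asymp_radius_sq F x (T c)"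
    using c by (simp add: is_asymp_centre_def)
  ultimately have "(norm (c - T c))\<^sup>2 \<le> 0" by linarith
  then show ?thesis
    by (simp add: Fix_def)
qed

text \<open>Tilting the centre by a small multiple of \<open>v\<close> changes the squared distances by
  \<open>- 2 s \<langle>v, x\<^sub>k - c\<rangle> + s\<^sup>2 \<parallel>v\<parallel>\<^sup>2\<close>, whose linear part dominates for small \<open>s\<close>.\<close>

lemma asymp_centre_no_drift:
  fixes x :: "'b \<Rightarrow> 'a::real_inner"
  assumes F: "F \<noteq> bot" and R: "\<And>k. norm (x k) \<le> R"
    and c: "is_asymp_centre F x c" and "0 < e"
  shows "\<not> (\<forall>\<^sub>F k in F. e \<le> inner v (x k - c))"
proof
  assume drift: "\<forall>\<^sub>F k in F. e \<le> inner v (x k - c)"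
  have "v \<noteq> 0"
  proof
    assume "v = 0"
    with drift \<open>0 < e\<close> have "\<forall>\<^sub>F k in F. False" by simp
    with F show False by (simp add: trivial_limit_def)
  qed
  define s where "s = e / (norm v)\<^sup>2"
  have "0 < s"
    using \<open>0 < e\<close> \<open>v \<noteq> 0\<close> by (simp add: s_def)
  have sv: "s * (norm v)\<^sup>2 = e"
    using \<open>v \<noteq> 0\<close> by (simp add: s_def)
  have "asymp_radius_sq F x (c + s *\<^sub>R v) \<le> asymp_radius_sq F x c + - (s * e)"
  proof (rule asymp_radius_sq_mono[OF F R])
    fix d :: real assume "0 < d"
    from drift show "\<forall>\<^sub>F k in F. (norm (x k - (c + s *\<^sub>R v)))\<^sup>2 \<le> (norm (x k - c))\<^sup>2 + - (s * e) + d"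
    proof eventually_elim
      case (elim k)
      have "(norm (x k - (c + s *\<^sub>R v)))\<^sup>2
          = (norm (x k - c))\<^sup>2 - 2 * (s * inner v (x k - c)) + s * (s * (norm v)\<^sup>2)"
        unfolding power2_norm_eq_inner
        by (simp add: inner_diff inner_add inner_commute algebra_simps)
      moreover have "s * e \<le> s * inner v (x k - c)"
        using elim \<open>0 < s\<close> by simp
      ultimately show ?case
        using \<open>0 < d\<close> unfolding sv by linarith
    qed
  qed
  moreover have "asymp_radius_sq F x c + (norm (c - (c + s *\<^sub>R v)))\<^sup>2 / 2
      \<le> asymp_radius_sq F x (c + s *\<^sub>R v)"
    using c unfolding is_asymp_centre_def by blast
  moreover have "0 < s * e"
    using \<open>0 < s\<close> \<open>0 < e\<close> by simp
  ultimately show False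
    using zero_le_power2[of "norm (c - (c + s *\<^sub>R v))"] by linarith
qed

text \<open>A version of Opial's lemma. Refining the filter does not change the limits of the distances to
  the fixed points, and all centres are fixed points; comparing the two centres in both
  directions shows that they coincide.\<close>

lemma nonexpansive_fejer_weakly_converges:
  fixes x :: "nat \<Rightarrow> 'a::{real_inner, complete_space}"
  assumes T: "nonexpansive T" and R: "\<And>k. norm (x k) \<le> R"
    and reg: "(\<lambda>k. norm (T (x k) - x k)) \<longlonglongrightarrow> 0"
    and fejer: "\<And>z. z \<in> Fix T \<Longrightarrow> convergent (\<lambda>k. (norm (x k - z))\<^sup>2)"
  shows "\<exists>p \<in> Fix T. weakly_converges x p"
proof -
  obtain c where c: "is_asymp_centre sequentially x c"
    by (rule asymp_centre_exists[OF sequentially_bot R])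
  have cFix: "c \<in> Fix T"
    by (rule asymp_centre_fixed[OF _ R c T reg]) simp
  have centre: "is_asymp_centre F x c" if F: "F \<noteq> bot" "F \<le> sequentially" for F
  proof -
    obtain d where d: "is_asymp_centre F x d"
      using asymp_centre_exists[OF F(1) R] .
    have dFix: "d \<in> Fix T"
      by (rule asymp_centre_fixed[OF F(1) R d T tendsto_mono[OF F(2) reg]])
    have same: "asymp_radius_sq F x z = asymp_radius_sq sequentially x z" if z: "z \<in> Fix T" for z
    proof -
      obtain l where l: "(\<lambda>k. (norm (x k - z))\<^sup>2) \<longlonglongrightarrow> l"
        using fejer[OF z] by (auto simp: convergent_def)
      show ?thesis
        using asymp_radius_sq_eq_lim[OF F(1) R tendsto_mono[OF F(2) l]]
          asymp_radius_sq_eq_lim[OF _ R l] by simp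
    qed
    have "asymp_radius_sq F x d + (norm (d - c))\<^sup>2 / 2 \<le> asymp_radius_sq F x c"
      "asymp_radius_sq sequentially x c + (norm (c - d))\<^sup>2 / 2 \<le> asymp_radius_sq sequentially x d"
      using c d by (simp_all add: is_asymp_centre_def)
    then have "(norm (d - c))\<^sup>2 \<le> 0"
      using same[OF cFix] same[OF dFix] zero_le_power2[of "norm (c - d)"] by linarith
    then have "d = c" by simp
    with d show ?thesis by simp
  qed
  have upper: "\<forall>\<^sub>F k in sequentially. inner v (x k - c) < e" if "0 < e" for v e
  proof (rule ccontr)
    assume "\<not> ?thesis"
    then have "\<exists>\<^sub>F k in sequentially. e \<le> inner v (x k - c)"
      by (simp add: frequently_def not_le)
    \<comment> \<open>the refinement plays the part of the subsequence of offending indices\<close>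
    then have ne: "inf sequentially (principal {k. e \<le> inner v (x k - c)}) \<noteq> bot"
      by (simp add: frequently_def trivial_limit_def eventually_inf_principal)
    show False
      using asymp_centre_no_drift[OF ne R centre[OF ne] that, of v]
      by (simp add: eventually_inf_principal)
  qed
  have "(\<lambda>k. f (x k)) \<longlonglongrightarrow> f c" if f: "bounded_linear f" for f :: "'a \<Rightarrow> real"
  proof -
    obtain v where v: "\<And>y. f y = inner v y"
      using riesz_representation[OF f] by blast
    show ?thesis
    proof (rule tendstoI)
      fix e :: real assume "0 < e"
      from upper[OF this, of v] upper[OF this, of "- v"]
      show "\<forall>\<^sub>F k in sequentially. dist (f (x k)) (f c) < e"
        by eventually_elim (simp add: v dist_real_def inner_diff_right abs_less_iff)
    qed
  qed
  with cFix show ?thesis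
    unfolding weakly_converges_def by blast
qed

section \<open>Averaged operators\<close>

lemma averaged_nonexpansive_ineq:
  fixes T :: "'a::real_inner \<Rightarrow> 'a"
  assumes "averaged_nonexpansive \<alpha> T" "0 < \<alpha>"
  shows "(norm (T x - T y))\<^sup>2
    \<le> (norm (x - y))\<^sup>2 - (1 - \<alpha>) / \<alpha> * (norm ((T x - x) - (T y - y)))\<^sup>2"
proof -
  obtain N where N: "\<And>x y. norm (N x - N y) \<le> norm (x - y)"
    and T: "T = (\<lambda>x. (1 - \<alpha>) *\<^sub>R x + \<alpha> *\<^sub>R N x)"
    using assms(1) unfolding averaged_nonexpansive_def nonexpansive_def by blast
  define d where "d = x - y"
  define e where "e = N x - N y"
  have 1: "T x - T y = (1 - \<alpha>) *\<^sub>R d + \<alpha> *\<^sub>R e"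
    and 2: "(T x - x) - (T y - y) = \<alpha> *\<^sub>R (e - d)"
    unfolding T d_def e_def by (simp_all add: algebra_simps)
  have "(norm (T x - T y))\<^sup>2
      = (1 - \<alpha>) * (norm d)\<^sup>2 + \<alpha> * (norm e)\<^sup>2 - (1 - \<alpha>) * \<alpha> * (norm (e - d))\<^sup>2"
    unfolding 1 power2_norm_eq_inner
    by (simp add: inner_diff inner_add inner_commute algebra_simps)
  also have "(1 - \<alpha>) * \<alpha> * (norm (e - d))\<^sup>2 = (1 - \<alpha>) / \<alpha> * (norm ((T x - x) - (T y - y)))\<^sup>2"
    unfolding 2 using assms(2) by (simp add: power2_eq_square)
  also have "\<alpha> * (norm e)\<^sup>2 \<le> \<alpha> * (norm d)\<^sup>2"
    using N[of x y] assms(2) unfolding d_def e_def by (intro mult_left_mono power_mono) auto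
  finally show ?thesis
    unfolding d_def by (simp add: algebra_simps)
qed

lemma averaged_nonexpansive_imp_nonexpansive:
  fixes T :: "'a::real_inner \<Rightarrow> 'a"
  assumes "averaged_nonexpansive \<alpha> T" "0 < \<alpha>" "\<alpha> < 1"
  shows "nonexpansive T"
  unfolding nonexpansive_def
proof (intro allI)
  fix x y
  have "0 \<le> (1 - \<alpha>) / \<alpha> * (norm ((T x - x) - (T y - y)))\<^sup>2"
    using assms by simp
  then have "(norm (T x - T y))\<^sup>2 \<le> (norm (x - y))\<^sup>2"
    using averaged_nonexpansive_ineq[OF assms(1,2), of x y] by linarith
  then show "norm (T x - T y) \<le> norm (x - y)"
    by (rule power2_le_imp_le) simp
qed

section \<open>Descent along the iteration\<close>

definition tkma_step :: "('a::real_inner \<Rightarrow> 'a) \<Rightarrow> real \<Rightarrow> 'a \<Rightarrow> 'a" where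
  "tkma_step T t x = (1 - t) *\<^sub>R T (T x) + t *\<^sub>R relax T (tkma_theta T x) x"

text \<open>The right-hand side equals \<open>(1 - t) \<kappa> (1 + \<theta>\<^sup>2) + t (1 + \<theta>) (\<kappa> - \<theta>)\<close>, and both summands are
  nonnegative if \<open>\<kappa> \<ge> 1\<close>. For \<open>\<kappa> < 1\<close> the second one can be negative; but the expression is affine in \<open>t\<close>
  and takes the nonnegative value \<open>\<kappa> (1 - \<theta>) (1 + \<kappa> \<theta>)\<close> at \<open>t = \<kappa>\<close>, which gives the decomposition used
  in that case.\<close>

lemma descent_coefficient:
  fixes \<kappa> t \<theta> :: real
  assumes "0 < \<kappa>" "0 < t" "t < min 1 \<kappa>" "\<bar>\<theta>\<bar> \<le> 1"
  shows "min 1 \<kappa> - t \<le> \<kappa> + t * \<theta> * (\<kappa> - 1) + \<theta>\<^sup>2 * (\<kappa> - t * \<kappa> - t)"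
proof (cases "1 \<le> \<kappa>")
  case True
  have "1 - t \<le> (1 - t) * \<kappa>"
    using True assms mult_left_mono[of 1 \<kappa> "1 - t"] by simp
  moreover have "0 \<le> (1 - t) * \<kappa> * \<theta>\<^sup>2"
    using assms by simp
  moreover have "0 \<le> t * ((1 + \<theta>) * (\<kappa> - \<theta>))"
    using assms True by (intro mult_nonneg_nonneg) auto
  moreover have "\<kappa> + t * \<theta> * (\<kappa> - 1) + \<theta>\<^sup>2 * (\<kappa> - t * \<kappa> - t)
      = (1 - t) * \<kappa> + (1 - t) * \<kappa> * \<theta>\<^sup>2 + t * ((1 + \<theta>) * (\<kappa> - \<theta>))"
    by (simp add: power2_eq_square algebra_simps)
  ultimately show ?thesis
    using True by simp
next
  case False
  have "\<bar>\<kappa> * \<theta>\<bar> \<le> 1"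
    using assms False by (simp add: abs_mult mult_le_one)
  then have "0 \<le> t * ((1 - \<theta>) * (1 + \<kappa> * \<theta>))"
    using assms by (intro mult_nonneg_nonneg) auto
  moreover have "0 \<le> (\<kappa> - t) * \<theta>\<^sup>2"
    using assms by simp
  moreover have "\<kappa> + t * \<theta> * (\<kappa> - 1) + \<theta>\<^sup>2 * (\<kappa> - t * \<kappa> - t)
      = (\<kappa> - t) + (\<kappa> - t) * \<theta>\<^sup>2 + t * ((1 - \<theta>) * (1 + \<kappa> * \<theta>))"
    by (simp add: power2_eq_square algebra_simps)
  ultimately show ?thesis
    using False by simp
qed

text \<open>All points are written relative to \<open>u = T x - z\<close>. Averagedness between \<open>x\<close> and \<open>z\<close> bounds \<open>\<langle>u, a\<rangle>\<close>,
  between \<open>T x\<close> and \<open>z\<close> it bounds \<open>\<langle>u, b\<rangle>\<close>, and between \<open>x\<close> and \<open>T x\<close> it gives \<open>\<parallel>b\<parallel> \<le> \<parallel>a\<parallel>\<close>, hence \<open>\<bar>\<theta>\<bar> \<le> 1\<close>.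
  The rest is the expansion of the square, in which \<open>\<parallel>b\<parallel>\<^sup>2\<close> may be replaced by the squared length
  \<open>\<theta>\<^sup>2 \<parallel>a\<parallel>\<^sup>2\<close> of its projection because its total coefficient is negative.\<close>

lemma tkma_step_descent:
  fixes T :: "'a::real_inner \<Rightarrow> 'a"
  assumes T: "averaged_nonexpansive \<alpha> T" and \<alpha>: "0 < \<alpha>" "\<alpha> < 1"
    and t: "0 < t" "t < min 1 ((1 - \<alpha>) / \<alpha>)" and z: "z \<in> Fix T"
  shows "(norm (tkma_step T t x - z))\<^sup>2
    \<le> (norm (x - z))\<^sup>2 - (min 1 ((1 - \<alpha>) / \<alpha>) - t) * (norm (T x - x))\<^sup>2"
proof -
  define \<kappa> where "\<kappa> = (1 - \<alpha>) / \<alpha>"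
  define \<theta> where "\<theta> = tkma_theta T x"
  define a where "a = T x - x"
  define b where "b = T (T x) - T x"
  define u where "u = T x - z"
  define A where "A = inner a a"
  define B where "B = inner b b"
  have "0 < \<kappa>"
    using \<alpha> by (simp add: \<kappa>_def)
  have "T z = z"
    using z by (simp add: Fix_def)
  note avg = averaged_nonexpansive_ineq[OF T \<alpha>(1), folded \<kappa>_def]
  have ua: "2 * inner u a \<le> (1 - \<kappa>) * A"
  proof -
    have "T x - T z = u" "x - z = u - a" "(T x - x) - (T z - z) = a"
      by (simp_all add: u_def a_def \<open>T z = z\<close>)
    then have "inner u u \<le> inner (u - a) (u - a) - \<kappa> * inner a a"
      using avg[of x z] by (simp only: power2_norm_eq_inner)
    then show ?thesis
      by (simp add: A_def inner_diff inner_commute algebra_simps)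
  qed
  have ub: "2 * inner u b \<le> - (1 + \<kappa>) * B"
  proof -
    have "T (T x) - T z = u + b" "T x - z = u" "(T (T x) - T x) - (T z - z) = b"
      by (simp_all add: u_def b_def \<open>T z = z\<close>)
    then have "inner (u + b) (u + b) \<le> inner u u - \<kappa> * inner b b"
      using avg[of "T x" z] by (simp only: power2_norm_eq_inner)
    then show ?thesis
      by (simp add: B_def inner_add inner_commute algebra_simps)
  qed
  have BA: "B \<le> A"
  proof -
    have "(norm (T (T x) - T x))\<^sup>2 \<le> (norm (T x - x))\<^sup>2"
      using averaged_nonexpansive_imp_nonexpansive[OF T \<alpha>]
      unfolding nonexpansive_def by (intro power_mono) auto
    then show ?thesis
      by (simp add: A_def B_def a_def b_def power2_norm_eq_inner)
  qed
  have ab: "inner a b = \<theta> * A"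
    by (cases "a = 0")
      (simp_all add: \<theta>_def tkma_theta_def A_def a_def[symmetric] b_def power2_norm_eq_inner
        inner_diff_right flip: a_def)
  have proj: "\<theta>\<^sup>2 * A \<le> B"
  proof -
    have "0 \<le> inner (b - \<theta> *\<^sub>R a) (b - \<theta> *\<^sub>R a)"
      by simp
    also have "\<dots> = B - 2 * \<theta> * inner a b + \<theta>\<^sup>2 * A"
      by (simp add: A_def B_def inner_diff inner_commute power2_eq_square algebra_simps)
    finally show ?thesis
      by (simp add: ab power2_eq_square algebra_simps)
  qed
  have "0 \<le> A"
    by (simp add: A_def)
  have \<theta>: "\<bar>\<theta>\<bar> \<le> 1"
  proof (cases "a = 0")
    case True
    then show ?thesis
      by (simp add: \<theta>_def tkma_theta_def a_def)
  next
    case False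
    then have "0 < A" by (simp add: A_def)
    moreover have "\<theta>\<^sup>2 * A \<le> 1 * A"
      using proj BA by simp
    ultimately have "\<theta>\<^sup>2 \<le> 1"
      using mult_le_cancel_right_pos by blast
    then show ?thesis
      by (simp add: abs_square_le_1)
  qed
  have step: "tkma_step T t x - z = u + (1 - t) *\<^sub>R b + (t * \<theta>) *\<^sub>R a"
    unfolding tkma_step_def relax_def \<theta>_def[symmetric] u_def a_def b_def
    by (simp add: algebra_simps)
  have "(norm (tkma_step T t x - z))\<^sup>2
      = inner u u + (1 - t) * (2 * inner u b) + t * \<theta> * (2 * inner u a)
        + (1 - t)\<^sup>2 * B + (t * \<theta>)\<^sup>2 * A + 2 * (1 - t) * (t * \<theta>) * (\<theta> * A)"
    unfolding step power2_norm_eq_inner A_def B_def ab[unfolded A_def, symmetric]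
    by (simp add: inner_add inner_commute power2_eq_square algebra_simps)
  also have "\<dots> \<le> inner u u - 2 * inner u a + (1 - (min 1 \<kappa> - t)) * A"
  proof -
    have 1: "(1 - t) * (2 * inner u b) \<le> (1 - t) * (- (1 + \<kappa>) * B)"
      using ub t by (intro mult_left_mono) auto
    have "\<bar>t * \<theta>\<bar> \<le> 1"
      using \<theta> t by (simp add: abs_mult mult_le_one)
    then have 2: "(1 + t * \<theta>) * (2 * inner u a) \<le> (1 + t * \<theta>) * ((1 - \<kappa>) * A)"
      using ua by (intro mult_left_mono) auto
    have 3: "(1 - t) * (\<kappa> + t) * (\<theta>\<^sup>2 * A) \<le> (1 - t) * (\<kappa> + t) * B"
      using proj t \<open>0 < \<kappa>\<close> by (intro mult_left_mono) auto
    have 4: "(min 1 \<kappa> - t) * A \<le> (\<kappa> + t * \<theta> * (\<kappa> - 1) + \<theta>\<^sup>2 * (\<kappa> - t * \<kappa> - t)) * A"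
      using descent_coefficient[OF \<open>0 < \<kappa>\<close> t(1) _ \<theta>] t(2) \<open>0 \<le> A\<close>
      by (intro mult_right_mono) (auto simp: \<kappa>_def)
    show ?thesis
      using 1 2 3 4 by (simp add: power2_eq_square algebra_simps)
  qed
  also have "\<dots> = (norm (x - z))\<^sup>2 - (min 1 \<kappa> - t) * (norm (T x - x))\<^sup>2"
  proof -
    have xz: "x - z = u - a" by (simp add: u_def a_def)
    show ?thesis
      unfolding xz power2_norm_eq_inner a_def[symmetric]
      by (simp add: A_def inner_diff inner_commute algebra_simps)
  qed
  finally show ?thesis
    unfolding \<kappa>_def .
qed

text \<open>The bound in the case \<open>\<alpha> > 1/2\<close> equals \<open>(\<kappa>\<^sup>2 + \<kappa> sqrt (\<kappa>\<^sup>2 + 8)) / 4\<close> with \<open>\<kappa> = (1 - \<alpha>) / \<alpha> < 1\<close>, and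
  \<open>\<kappa> + sqrt (\<kappa>\<^sup>2 + 8)\<close> increases to \<open>4\<close> as \<open>\<kappa>\<close> increases to \<open>1\<close>.\<close>

lemma tkma_threshold_le:
  fixes \<alpha> :: real
  assumes "1/2 < \<alpha>" "\<alpha> < 1"
  shows "((1 - \<alpha>)\<^sup>2 + (1 - \<alpha>) * sqrt ((1 - \<alpha>)\<^sup>2 + 8 * \<alpha>\<^sup>2)) / (4 * \<alpha>\<^sup>2) \<le> (1 - \<alpha>) / \<alpha>"
proof -
  have "0 \<le> 8 * (\<alpha> * (2 * \<alpha> - 1))"
    using assms by simp
  then have "(1 - \<alpha>)\<^sup>2 + 8 * \<alpha>\<^sup>2 \<le> (5 * \<alpha> - 1)\<^sup>2"
    by (simp add: power2_eq_square algebra_simps)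
  then have "sqrt ((1 - \<alpha>)\<^sup>2 + 8 * \<alpha>\<^sup>2) \<le> 5 * \<alpha> - 1"
    using assms by (intro real_le_lsqrt) auto
  then have "(1 - \<alpha>) * ((1 - \<alpha>) + sqrt ((1 - \<alpha>)\<^sup>2 + 8 * \<alpha>\<^sup>2)) \<le> (1 - \<alpha>) * (4 * \<alpha>)"
    using assms by (intro mult_left_mono) auto
  then have "((1 - \<alpha>)\<^sup>2 + (1 - \<alpha>) * sqrt ((1 - \<alpha>)\<^sup>2 + 8 * \<alpha>\<^sup>2)) / (4 * \<alpha>\<^sup>2)
      \<le> (1 - \<alpha>) * (4 * \<alpha>) / (4 * \<alpha>\<^sup>2)"
    by (intro divide_right_mono) (simp_all add: power2_eq_square algebra_simps)
  also have "\<dots> = (1 - \<alpha>) / \<alpha>"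
    using assms by (simp add: power2_eq_square)
  finally show ?thesis .
qed

theorem theorem4p4:
  fixes T :: "'a::{real_inner, complete_space} \<Rightarrow> 'a"
    and \<alpha> t :: real and x0 :: 'a and x :: "nat \<Rightarrow> 'a"
  assumes "0 < \<alpha>" and "\<alpha> < 1"
    and "averaged_nonexpansive \<alpha> T"
    and "Fix T \<noteq> {}"
    and "tkma_sequence T t x0 x"
    and "\<And>k. T (x k) \<noteq> x k"
    and "(\<alpha> \<in> {0<..1/2} \<and> t \<in> {0<..<1}) \<or>
         (\<alpha> \<in> {1/2<..<1} \<and>
          t \<in> {0<..<((1 - \<alpha>)\<^sup>2 + (1 - \<alpha>) * sqrt ((1 - \<alpha>)\<^sup>2 + 8 * \<alpha>\<^sup>2)) / (4 * \<alpha>\<^sup>2)})"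
  shows "\<exists>p \<in> Fix T. weakly_converges x p"
proof -
  define \<delta> where "\<delta> = min 1 ((1 - \<alpha>) / \<alpha>) - t"
  have t: "0 < t" "t < min 1 ((1 - \<alpha>) / \<alpha>)"
  proof -
    show "0 < t" using assms(7) by auto
    from assms(7) show "t < min 1 ((1 - \<alpha>) / \<alpha>)"
    proof
      assume a: "\<alpha> \<in> {0<..1/2} \<and> t \<in> {0<..<1}"
      then have "1 \<le> (1 - \<alpha>) / \<alpha>" by (simp add: field_simps)
      with a show ?thesis by auto
    next
      assume b: "\<alpha> \<in> {1/2<..<1} \<and>
        t \<in> {0<..<((1 - \<alpha>)\<^sup>2 + (1 - \<alpha>) * sqrt ((1 - \<alpha>)\<^sup>2 + 8 * \<alpha>\<^sup>2)) / (4 * \<alpha>\<^sup>2)}"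
      then have "t < (1 - \<alpha>) / \<alpha>"
        using tkma_threshold_le[of \<alpha>] by auto
      moreover have "(1 - \<alpha>) / \<alpha> < 1"
        using b by (auto simp: field_simps)
      ultimately show ?thesis by simp
    qed
  qed
  then have "0 < \<delta>" by (simp add: \<delta>_def)
  have "x (Suc k) = tkma_step T t (x k)" for k
    using assms(5) by (simp add: tkma_sequence_def tkma_step_def)
  then have descent: "(norm (x (Suc k) - z))\<^sup>2 \<le> (norm (x k - z))\<^sup>2 - \<delta> * (norm (T (x k) - x k))\<^sup>2"
    if "z \<in> Fix T" for z k
    using tkma_step_descent[OF assms(3,1,2) t that] by (simp add: \<delta>_def)
  have dec: "decseq (\<lambda>k. (norm (x k - z))\<^sup>2)" if "z \<in> Fix T" for z
  proof (rule decseq_SucI)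
    fix k
    have "0 \<le> \<delta> * (norm (T (x k) - x k))\<^sup>2"
      using \<open>0 < \<delta>\<close> by simp
    then show "(norm (x (Suc k) - z))\<^sup>2 \<le> (norm (x k - z))\<^sup>2"
      using descent[OF that, of k] by linarith
  qed
  have conv: "convergent (\<lambda>k. (norm (x k - z))\<^sup>2)" if "z \<in> Fix T" for z
    using decseq_convergent[OF dec[OF that], of 0] by (metis convergentI zero_le_power2)
  obtain z where z: "z \<in> Fix T"
    using assms(4) by blast
  obtain l where l: "(\<lambda>k. (norm (x k - z))\<^sup>2) \<longlonglongrightarrow> l"
    using conv[OF z] by (auto simp: convergent_def)
  have "norm (x k) \<le> norm (x 0 - z) + norm z" for k
  proof -
    have "(norm (x k - z))\<^sup>2 \<le> (norm (x 0 - z))\<^sup>2"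
      using dec[OF z] by (simp add: decseq_def)
    then have "norm (x k - z) \<le> norm (x 0 - z)"
      by (rule power2_le_imp_le) simp
    then show ?thesis
      using norm_triangle_ineq[of "x k - z" z] by simp
  qed
  moreover have "(\<lambda>k. norm (T (x k) - x k)) \<longlonglongrightarrow> 0"
  proof -
    have "(\<lambda>k. ((norm (x k - z))\<^sup>2 - (norm (x (Suc k) - z))\<^sup>2) / \<delta>) \<longlonglongrightarrow> (l - l) / \<delta>"
      using \<open>0 < \<delta>\<close> by (intro tendsto_intros l LIMSEQ_Suc[OF l]) simp
    then have "(\<lambda>k. ((norm (x k - z))\<^sup>2 - (norm (x (Suc k) - z))\<^sup>2) / \<delta>) \<longlonglongrightarrow> 0"
      by simp
    moreover have "(norm (T (x k) - x k))\<^sup>2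
        \<le> ((norm (x k - z))\<^sup>2 - (norm (x (Suc k) - z))\<^sup>2) / \<delta>" for k
      using descent[OF z, of k] \<open>0 < \<delta>\<close> by (simp add: field_simps)
    ultimately have "(\<lambda>k. (norm (T (x k) - x k))\<^sup>2) \<longlonglongrightarrow> 0"
      by (intro Lim_null_comparison[of "\<lambda>k. (norm (T (x k) - x k))\<^sup>2", OF always_eventually]) auto
    then show ?thesis
      using tendsto_real_sqrt by fastforce
  qed
  ultimately show ?thesis
    using nonexpansive_fejer_weakly_converges
      [OF averaged_nonexpansive_imp_nonexpansive[OF assms(3,1,2)]] conv by blast
qed

end
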